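(* Let $\varepsilon>0$ and let $k=k(n)$ be a function with $k=o(n)$. Then for every sufficiently large $n$, every oriented graph $D$ on $n$ vertices with minimum degree at least $n-k$ has an anti-directed path of length at least $(1-\varepsilon)n$.
   Context: An oriented graph is a digraph obtained by orienting the edges of a simple undirected graph; the degree of a vertex is its number of neighbours (in- plus out-neighbours). An oriented path $x_1\dots x_p$ is anti-directed if every two consecutive arcs have opposite orientations. *)

theory Defs
  imports "HOL-Library.Landau_Symbols" "Graph_Theory.Graph_Theory"
begin

locale oriented_graph = pair_digraph +
  assumes no_2_cycles: "(u, v) \<in> parcs G \<Longrightarrow> (v, u) \<notin> parcs G"

definition neighbours :: "'a pair_pre_digraph \<Rightarrow> 'a \<Rightarrow> 'a set" where
  "neighbours D v = {u \<in> pverts D. (u, v) \<in> parcs D \<or> (v, u) \<in> parcs D}"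

definition degree :: "'a pair_pre_digraph \<Rightarrow> 'a \<Rightarrow> nat" where
  "degree D v = card (neighbours D v)"

(* Unspecified for a digraph without vertices. *)
definition min_degree :: "'a pair_pre_digraph \<Rightarrow> nat" where
  "min_degree D = Min (degree D ` pverts D)"

(* A path whose arcs may be traversed in either direction, i.e. a path of the underlying
   undirected graph, given by its list of vertices; vwalk_length counts its arcs. *)
definition oriented_path :: "'a pair_pre_digraph \<Rightarrow> 'a list \<Rightarrow> bool" where
  "oriented_path D xs \<longleftrightarrow> vpath xs (with_proj (mk_symmetric (with_proj D)))"

(* In an oriented graph, an arc between the i-th and the next vertex of an oriented path that
   does not point forwards points backwards, so the inequality of truth values says that the
   two consecutive arcs have opposite orientations. *)
definition antidirected_path :: "'a pair_pre_digraph \<Rightarrow> 'a list \<Rightarrow> bool" where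
  "antidirected_path D xs \<longleftrightarrow> oriented_path D xs \<and>
     (\<forall>i. i + 2 < length xs \<longrightarrow>
        ((xs ! i, xs ! (i + 1)) \<in> parcs D) \<noteq> ((xs ! (i + 1), xs ! (i + 2)) \<in> parcs D))"

end

theory Submission
  imports Defs
begin

text \<open>
  Let every vertex have at most \<open>\<kappa>\<close> non-neighbours (itself included), let \<open>P\<close> be a longest
  anti-directed path, and suppose that the set \<open>R\<close> of vertices off \<open>P\<close> has at least
  \<open>100 (\<kappa> + 1)\<close> elements. Remove the vertices of \<open>P\<close> one at a time from one end, and let \<open>W\<close> and \<open>B\<close>
  be the removed sinks and sources. Inductively, almost all arcs go from \<open>W\<close> to \<open>R\<close>, from \<open>R\<close> to \<open>B\<close>
  and from \<open>W\<close> to \<open>B\<close>. The removed vertices together with \<open>R\<close> then carry an anti-directed path with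
  more than \<open>card W + card B\<close> vertices that starts at any prescribed vertex, as a source or as a
  sink, up to \<open>\<kappa>\<close> exceptions: a zigzag between \<open>R\<close> and part of \<open>B\<close>, continued by a path from \<open>W\<close> to
  the rest of \<open>B\<close> and \<open>R\<close> found by depth-first search. Since \<open>P\<close> is longest, the next vertex of \<open>P\<close>
  cannot be linked to such a path, which forces its arcs to \<open>R \<union> W \<union> B\<close> into the direction that
  keeps the induction going. When \<open>P\<close> is exhausted, the new path is longer than \<open>P\<close>.
\<close>

section \<open>Anti-directed paths with roles\<close>

text \<open>
  The set \<open>D\<close> consists of the vertices that depth-first search has abandoned: they have no
  neighbour among the vertices that are still unvisited.
\<close>

lemma dfs_state:
  fixes E :: "'b \<Rightarrow> 'b \<Rightarrow> bool"
  assumes "finite H" "d \<le> card H"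
  shows "\<exists>D ps. D \<subseteq> H \<and> card D = d \<and> set ps \<subseteq> H - D \<and> distinct ps \<and> successively E ps \<and>
           (\<forall>x\<in>D. \<forall>y\<in>H - D - set ps. \<not> E y x)"
  using assms(2)
proof (induction d)
  case 0
  show ?case by (rule exI[of _ "{}"], rule exI[of _ "[]"]) auto
next
  case (Suc d)
  define state where "state D ps \<longleftrightarrow> D \<subseteq> H \<and> card D = d \<and> set ps \<subseteq> H - D \<and> distinct ps \<and>
    successively E ps \<and> (\<forall>x\<in>D. \<forall>y\<in>H - D - set ps. \<not> E y x)" for D ps
  have "\<exists>D ps. state D ps"
    using Suc unfolding state_def by auto
  then obtain D where "\<exists>ps. state D ps" by blast
  moreover have "length ps \<le> card H" if "state D ps" for ps
  proof -
    have "card (set ps) \<le> card H"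
      using that assms(1) unfolding state_def by (intro card_mono) auto
    then show ?thesis using that by (simp add: state_def distinct_card)
  qed
  \<comment> \<open>With \<open>D\<close> fixed, \<open>ps\<close> is a longest stack, so no
    unvisited vertex can be pushed. Hence \<open>ps\<close> is nonempty, and its head has no
    unvisited neighbour and can be moved to \<open>D\<close>.\<close>
  ultimately obtain ps where ps: "state D ps" and max: "\<And>qs. state D qs \<Longrightarrow> length qs \<le> length ps"
    using ex_has_greatest_nat[of "state D" _ length "Suc (card H)"] by (metis less_Suc_eq_le)
  have fin: "finite D" using ps assms(1) by (auto simp: state_def intro: finite_subset)
  have no_ext: "\<not> state D (y # ps)" for y
    using max[of "y # ps"] by auto
  show ?case
  proof (cases ps)
    case Nil
    have "D \<noteq> H" using ps Suc.prems by (auto simp: state_def)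
    then obtain y where "y \<in> H" "y \<notin> D" using ps by (auto simp: state_def)
    then have "state D [y]" using ps Nil by (auto simp: state_def)
    then show ?thesis using no_ext Nil by auto
  next
    case (Cons x qs)
    have "\<not> E y x" if "y \<in> H - D - set ps" for y
      using no_ext[of y] ps that Cons by (auto simp: state_def)
    then have "insert x D \<subseteq> H \<and> card (insert x D) = Suc d \<and> set qs \<subseteq> H - insert x D \<and> distinct qs \<and>
        successively E qs \<and> (\<forall>x'\<in>insert x D. \<forall>y\<in>H - insert x D - set qs. \<not> E y x')"
      using ps Cons fin by (auto simp: state_def successively_Cons)
    then show ?thesis by blast
  qed
qed

text \<open>
  The vertices of a path carry a flag that is true for sources and false for sinks. With it,
  adjacency becomes a symmetric relation and paths can be reversed and concatenated freely.
\<close>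

definition adj :: "('v \<Rightarrow> 'v \<Rightarrow> bool) \<Rightarrow> 'v \<times> bool \<Rightarrow> 'v \<times> bool \<Rightarrow> bool" where
  "adj arc p q \<longleftrightarrow> snd p \<noteq> snd q \<and> (if snd p then arc (fst p) (fst q) else arc (fst q) (fst p))"

definition alt_path :: "('v \<Rightarrow> 'v \<Rightarrow> bool) \<Rightarrow> 'v set \<Rightarrow> ('v \<times> bool) list \<Rightarrow> bool" where
  "alt_path arc X ps \<longleftrightarrow> successively (adj arc) ps \<and> distinct (map fst ps) \<and> fst ` set ps \<subseteq> X"

definition role :: "bool \<Rightarrow> ('v \<times> bool) list \<Rightarrow> 'v set" where
  "role s ps = {x. (x, s) \<in> set ps}"

lemma adj_sym: "adj arc p q \<longleftrightarrow> adj arc q p"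
  by (auto simp: adj_def)

lemma alt_path_Nil [simp]: "alt_path arc X []"
  by (simp add: alt_path_def)

lemma alt_path_rev [simp]: "alt_path arc X (rev ps) \<longleftrightarrow> alt_path arc X ps"
proof -
  have "successively (\<lambda>x y. adj arc y x) ps \<longleftrightarrow> successively (adj arc) ps"
    by (intro successively_cong) (auto simp: adj_sym)
  then show ?thesis by (simp add: alt_path_def rev_map[symmetric])
qed

lemma alt_path_append_iff:
  "alt_path arc X (ps @ qs) \<longleftrightarrow> alt_path arc X ps \<and> alt_path arc X qs \<and> fst ` set ps \<inter> fst ` set qs = {} \<and>
     (ps = [] \<or> qs = [] \<or> adj arc (last ps) (hd qs))"
  by (auto simp: alt_path_def successively_append_iff)

lemma alt_path_Cons_iff:
  "alt_path arc X (p # qs) \<longleftrightarrow> fst p \<in> X \<and> alt_path arc X qs \<and> fst p \<notin> fst ` set qs \<and>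
     (qs = [] \<or> adj arc p (hd qs))"
  by (auto simp: alt_path_def successively_Cons)

lemma alt_path_mono: "alt_path arc X ps \<Longrightarrow> X \<subseteq> Y \<Longrightarrow> alt_path arc Y ps"
  by (auto simp: alt_path_def)

lemma finite_role [simp]: "finite (role s ps)"
proof -
  have "role s ps \<subseteq> fst ` set ps" by (force simp: role_def)
  then show ?thesis by (rule finite_subset) simp
qed

lemma role_Cons: "role s (p # ps) = (if snd p = s then insert (fst p) (role s ps) else role s ps)"
  by (cases p) (auto simp: role_def)

lemma role_subset: "role s ps \<subseteq> fst ` set ps"
  by (force simp: role_def)

lemma role_Un: "role s ps \<union> role (\<not> s) ps = fst ` set ps"
proof
  show "fst ` set ps \<subseteq> role s ps \<union> role (\<not> s) ps"
  proof
    fix x assume "x \<in> fst ` set ps"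
    then obtain t where "(x, t) \<in> set ps" by force
    then show "x \<in> role s ps \<union> role (\<not> s) ps" by (cases "t = s") (auto simp: role_def)
  qed
  show "role s ps \<union> role (\<not> s) ps \<subseteq> fst ` set ps"
    using role_subset[of s ps] role_subset[of "\<not> s" ps] by blast
qed

lemma length_eq_card_roles:
  assumes "distinct (map fst ps)"
  shows "length ps = card (role s ps) + card (role (\<not> s) ps)"
  using assms
proof (induction ps)
  case (Cons p ps)
  have "fst p \<notin> role t ps" for t using Cons.prems role_subset[of t ps] by auto
  then show ?case using Cons by (auto simp: role_Cons)
qed (auto simp: role_def)

text \<open>Roles alternate, so two consecutive vertices contain exactly one of role
  \<open>s\<close>. The induction removes vertices in pairs.\<close>

lemma length_le_role:
  assumes "alt_path arc X ps"
  shows "length ps \<le> 2 * card (role s ps) + 1"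
  using assms
proof (induction ps rule: induct_list012)
  case (3 p q ps)
  have "alt_path arc X ps" using 3 by (auto simp: alt_path_Cons_iff)
  then have IH: "length ps \<le> 2 * card (role s ps) + 1" using 3 by blast
  have "fst p \<notin> role s ps" "fst q \<notin> role s ps"
    using 3(3) role_subset[of s ps] by (auto simp: alt_path_Cons_iff)
  moreover have "snd p \<noteq> snd q" using 3(3) by (auto simp: alt_path_Cons_iff adj_def)
  ultimately show ?case using IH by (auto simp: role_Cons)
qed (auto simp: role_Cons)

lemma role_le_length:
  assumes "alt_path arc X ps"
  shows "2 * card (role s ps) \<le> length ps + 1"
  using length_le_role[OF assms, of "\<not> s"] length_eq_card_roles[of ps s] assms
  by (auto simp: alt_path_def)

text \<open>Stop the depth-first search when 2m vertices are abandoned. One class then has at least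
  m of them, so by density fewer than m vertices of the other class are unvisited. At most m of that
  class are abandoned, and the others, at least N - 2m, lie on the path.\<close>

lemma long_alternating_path:
  fixes arc :: "'v \<Rightarrow> 'v \<Rightarrow> bool"
  assumes fin: "finite A" "finite B" and disj: "A \<inter> B = {}"
    and dense: "\<And>A' B'. A' \<subseteq> A \<Longrightarrow> B' \<subseteq> B \<Longrightarrow> m \<le> card A' \<Longrightarrow> m \<le> card B' \<Longrightarrow> \<exists>x\<in>A'. \<exists>y\<in>B'. arc x y"
    and N: "N \<le> card A" "N \<le> card B"
  shows "\<exists>ps. alt_path arc (A \<union> B) ps \<and> role True ps \<subseteq> A \<and> role False ps \<subseteq> B \<and> 2 * N \<le> length ps + 4 * m + 1"
proof (cases "2 * m \<le> card A + card B")
  case False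
  then have "2 * N \<le> 4 * m" using N by linarith
  then show ?thesis by (intro exI[of _ "[]"]) (auto simp: role_def)
next
  case True
  define H where "H = A \<times> {True} \<union> B \<times> {False}"
  have finH: "finite H" using fin by (auto simp: H_def)
  have cardH: "card H = card A + card B"
    unfolding H_def by (subst card_Un_disjoint) (use fin in \<open>auto simp: card_cartesian_product\<close>)
  obtain D ps where D: "D \<subseteq> H" "card D = 2 * m" and ps: "set ps \<subseteq> H - D" "distinct ps" "successively (adj arc) ps"
    and sep: "\<And>x y. x \<in> D \<Longrightarrow> y \<in> H - D - set ps \<Longrightarrow> \<not> adj arc y x"
    using dfs_state[OF finH, of "2 * m" "adj arc"] True cardH by auto
  have "inj_on fst H" using disj by (auto simp: H_def inj_on_def)
  then have "distinct (map fst ps)"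
    using ps by (auto simp: distinct_map intro: inj_on_subset)
  then have path: "alt_path arc (A \<union> B) ps"
    using ps by (auto simp: alt_path_def H_def)
  have roles: "role True ps \<subseteq> A" "role False ps \<subseteq> B"
    using ps by (auto simp: role_def H_def)
  define slice where "slice s X = {x. (x, s) \<in> X}" for s and X :: "('v \<times> bool) set"
  have slice_sub: "slice True D \<subseteq> A" "slice False D \<subseteq> B" using D by (auto simp: slice_def H_def)
  then have fins: "finite (slice True D)" "finite (slice False D)" using fin by (auto intro: finite_subset)
  have "D = slice True D \<times> {True} \<union> slice False D \<times> {False}"
    unfolding slice_def by (auto, (metis (full_types))+)
  then have "card D = card (slice True D \<times> {True} \<union> slice False D \<times> {False})" by simp
  also have "\<dots> = card (slice True D) + card (slice False D)"
    by (subst card_Un_disjoint) (use fins in \<open>auto simp: card_cartesian_product\<close>)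
  finally have sum: "card (slice True D) + card (slice False D) = 2 * m" using D by simp
  have A_split: "card A \<le> card (slice True D) + card (role True ps) + card (A - slice True D - role True ps)"
  proof -
    have "A = slice True D \<union> role True ps \<union> (A - slice True D - role True ps)" using slice_sub roles by auto
    then show ?thesis by (metis card_Un_le add_le_cancel_right le_trans)
  qed
  have B_split: "card B \<le> card (slice False D) + card (role False ps) + card (B - slice False D - role False ps)"
  proof -
    have "B = slice False D \<union> role False ps \<union> (B - slice False D - role False ps)" using slice_sub roles by auto
    then show ?thesis by (metis card_Un_le add_le_cancel_right le_trans)
  qed
  have "N \<le> card (role True ps) + 2 * m \<or> N \<le> card (role False ps) + 2 * m"
  proof (cases "m \<le> card (slice True D)")
    case True
    have "card (B - slice False D - role False ps) < m"
    proof (rule ccontr)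
      assume "\<not> ?thesis"
      then obtain x y where "x \<in> slice True D" "y \<in> B - slice False D - role False ps" "arc x y"
        using dense[OF slice_sub(1), of "B - slice False D - role False ps"] True by auto
      then show False using sep[of "(x, True)" "(y, False)"] by (auto simp: slice_def role_def H_def adj_def)
    qed
    then show ?thesis using True sum B_split N by linarith
  next
    case False
    then have F: "m \<le> card (slice False D)" using sum by linarith
    have "card (A - slice True D - role True ps) < m"
    proof (rule ccontr)
      assume "\<not> ?thesis"
      then obtain x y where "x \<in> A - slice True D - role True ps" "y \<in> slice False D" "arc x y"
        using dense[OF _ slice_sub(2), of "A - slice True D - role True ps"] F by auto
      then show False using sep[of "(y, False)" "(x, True)"] by (auto simp: slice_def role_def H_def adj_def)
    qed
    then show ?thesis using F sum A_split N by linarith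
  qed
  then have "2 * N \<le> length ps + 4 * m + 1"
    using role_le_length[OF path, of True] role_le_length[OF path, of False] by linarith
  then show ?thesis using path roles by blast
qed

text \<open>Cut \<open>ps\<close> after \<open>b\<close> and \<open>qs\<close> before
  \<open>w\<close>, and join them by the arc. The arc is sought between windows of 2m vertices: the
  loss stays below 4m, while alternation puts at least m vertices of each role into each
  window.\<close>

lemma alt_path_link:
  assumes ps: "alt_path arc X ps" and qs: "alt_path arc X qs" and disj: "fst ` set ps \<inter> fst ` set qs = {}"
    and len: "2 * m \<le> length ps" "2 * m \<le> length qs"
    and arc: "w \<in> role True (take (2 * m) qs)" "b \<in> role False (drop (length ps - 2 * m) ps)" "arc w b"
  shows "\<exists>rs. alt_path arc X rs \<and> rs \<noteq> [] \<and> hd rs = hd ps \<and> length ps + length qs \<le> length rs + 4 * m"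
proof -
  obtain u v where uv: "drop (length ps - 2 * m) ps = u @ (b, False) # v"
    using arc(2) by (auto simp: role_def dest: split_list)
  obtain u' v' where uv': "take (2 * m) qs = u' @ (w, True) # v'"
    using arc(1) by (auto simp: role_def dest: split_list)
  define t where "t = take (length ps - 2 * m) ps @ u"
  define t' where "t' = v' @ drop (2 * m) qs"
  have P: "ps = t @ (b, False) # v"
    using uv append_take_drop_id[of "length ps - 2 * m" ps] unfolding t_def by simp
  have Q: "qs = u' @ (w, True) # t'"
    using uv' append_take_drop_id[of "2 * m" qs] unfolding t'_def by simp
  have "length v \<le> 2 * m" using arg_cong[OF uv, of length] len by simp
  moreover have "length u' \<le> 2 * m" using arg_cong[OF uv', of length] len by simp
  ultimately have "length ps + length qs \<le> length (t @ (b, False) # (w, True) # t') + 4 * m"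
    unfolding P Q by simp
  moreover have "alt_path arc X (t @ (b, False) # (w, True) # t')"
    using ps qs disj arc(3) unfolding P Q alt_path_append_iff alt_path_Cons_iff
    by (auto simp: adj_def)
  moreover have "hd (t @ (b, False) # (w, True) # t') = hd ps"
    unfolding P by (cases t) auto
  ultimately show ?thesis by blast
qed

section \<open>Near tournaments\<close>

locale near_tournament =
  fixes V :: "'v set" and arc :: "'v \<Rightarrow> 'v \<Rightarrow> bool" and \<kappa> :: nat
  assumes finite_V: "finite V"
    and asym: "arc x y \<Longrightarrow> \<not> arc y x"
    and nonadjacent: "x \<in> V \<Longrightarrow> card {y \<in> V. \<not> arc x y \<and> \<not> arc y x} \<le> \<kappa>"
begin

text \<open>Reversal exchanges sources and sinks, so the arguments below need only one of the two
  roles.\<close>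

lemma near_tournament_converse: "near_tournament V (\<lambda>x y. arc y x) \<kappa>"
proof
  fix x assume "x \<in> V"
  then have "card {y \<in> V. \<not> arc x y \<and> \<not> arc y x} \<le> \<kappa>" by (rule nonadjacent)
  also have "{y \<in> V. \<not> arc x y \<and> \<not> arc y x} = {y \<in> V. \<not> arc y x \<and> \<not> arc x y}" by auto
  finally show "card {y \<in> V. \<not> arc y x \<and> \<not> arc x y} \<le> \<kappa>" .
qed (use finite_V asym in auto)

text \<open>All of \<open>Y\<close> consists of non-neighbours of any one of its elements.\<close>

lemma card_arcless:
  assumes "Y \<subseteq> V" "\<And>x y. x \<in> Y \<Longrightarrow> y \<in> Y \<Longrightarrow> \<not> arc x y"
  shows "card Y \<le> \<kappa>"
proof (cases "Y = {}")
  case False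
  then obtain x where x: "x \<in> Y" by auto
  have "card Y \<le> card {y \<in> V. \<not> arc x y \<and> \<not> arc y x}"
    using assms x finite_V by (intro card_mono) auto
  then show ?thesis using nonadjacent[of x] x assms(1) by (auto intro: order_trans)
qed auto

lemma ex_arc:
  assumes "Y \<subseteq> V" "\<kappa> < card Y"
  shows "\<exists>x\<in>Y. \<exists>y\<in>Y. arc x y"
  using card_arcless[OF assms(1)] assms(2) by force

text \<open>Besides the few out-neighbours, only non-neighbours of \<open>x\<close> fail to send it
  an arc. This is the origin of the bounds 2\<kappa> in the layered structure.\<close>

lemma card_not_in:
  assumes "x \<in> V" "Y \<subseteq> V" "card {y \<in> Y. arc x y} \<le> \<kappa>"
  shows "card {y \<in> Y. \<not> arc y x} \<le> 2 * \<kappa>"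
proof -
  have fin: "finite Y" using assms finite_V by (auto intro: finite_subset)
  have "card {y \<in> Y. \<not> arc y x} \<le> card ({y \<in> Y. arc x y} \<union> {y \<in> V. \<not> arc x y \<and> \<not> arc y x})"
    using assms fin finite_V by (intro card_mono) auto
  also have "\<dots> \<le> card {y \<in> Y. arc x y} + card {y \<in> V. \<not> arc x y \<and> \<not> arc y x}"
    by (rule card_Un_le)
  finally show ?thesis using nonadjacent[OF assms(1)] assms(3) by linarith
qed

text \<open>Inside the set \<open>L\<close> of these vertices, out-degrees are at most d, and
  in-degrees have the same sum. Since every vertex has at least \<open>card L\<close> - \<kappa>
  neighbours in \<open>L\<close>, double counting bounds \<open>card L\<close>.\<close>

lemma card_low_outdegree:
  assumes "X \<subseteq> V"
  shows "card {x \<in> X. card {y \<in> X. arc x y} < d} \<le> 2 * d + \<kappa>"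
proof -
  define L where "L = {x \<in> X. card {y \<in> X. arc x y} < d}"
  have L: "L \<subseteq> V" "finite L" using assms finite_V by (auto simp: L_def intro: finite_subset)
  have finX: "finite X" using assms finite_V by (auto intro: finite_subset)
  have out: "card {y \<in> L. arc x y} \<le> d" if "x \<in> L" for x
  proof -
    have "card {y \<in> L. arc x y} \<le> card {y \<in> X. arc x y}"
      using finX by (intro card_mono) (auto simp: L_def)
    then show ?thesis using that by (simp add: L_def)
  qed
  have deg: "card L \<le> \<kappa> + card {y \<in> L. arc x y} + card {y \<in> L. arc y x}" if "x \<in> L" for x
  proof -
    have "card L \<le> card ({y \<in> V. \<not> arc x y \<and> \<not> arc y x} \<union> {y \<in> L. arc x y} \<union> {y \<in> L. arc y x})"
      using L finite_V by (intro card_mono) auto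
    also have "\<dots> \<le> card {y \<in> V. \<not> arc x y \<and> \<not> arc y x} + card {y \<in> L. arc x y} + card {y \<in> L. arc y x}"
      by (meson card_Un_le add_le_mono1 order_trans)
    finally show ?thesis using nonadjacent[of x] that L by force
  qed
  have swap: "(\<Sum>x\<in>L. card {y \<in> L. arc y x}) = (\<Sum>x\<in>L. card {y \<in> L. arc x y})"
  proof -
    have "(\<Sum>x\<in>L. card {y \<in> L. arc y x}) = (\<Sum>x\<in>L. \<Sum>y\<in>L. if arc y x then 1 else 0)"
      using L by (simp add: sum.If_cases Int_def)
    also have "\<dots> = (\<Sum>y\<in>L. \<Sum>x\<in>L. if arc y x then 1 else 0)" by (rule sum.swap)
    finally show ?thesis using L by (simp add: sum.If_cases Int_def)
  qed
  have "card L * card L \<le> (\<Sum>x\<in>L. \<kappa> + card {y \<in> L. arc x y} + card {y \<in> L. arc y x})"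
    using sum_mono[of L "\<lambda>_. card L"] deg by simp
  also have "\<dots> = card L * \<kappa> + 2 * (\<Sum>x\<in>L. card {y \<in> L. arc x y})"
    by (simp add: sum.distrib swap)
  also have "\<dots> \<le> card L * \<kappa> + 2 * (card L * d)"
    using sum_mono[of L _ "\<lambda>_. d"] out by simp
  finally have "card L * card L \<le> card L * (2 * d + \<kappa>)" by (simp add: algebra_simps)
  then show ?thesis unfolding L_def[symmetric] by (cases "card L = 0") auto
qed

end

section \<open>Long paths in layered near tournaments\<close>

text \<open>The new paths reverse the old roles: vertices of \<open>W\<close> become sources, those
  of \<open>B\<close> sinks. Between \<open>W\<close> and \<open>B\<close> only large subsets are
  controlled, since a removed vertex has bounds only towards \<open>R\<close> and the vertices
  removed before it.\<close>

locale layered = near_tournament +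
  fixes R W B :: "'a set"
  assumes layers: "R \<union> W \<union> B \<subseteq> V" "R \<inter> W = {}" "R \<inter> B = {}" "W \<inter> B = {}"
    and R_to_B: "b \<in> B \<Longrightarrow> card {r \<in> R. \<not> arc r b} \<le> 2 * \<kappa>"
    and W_to_R: "w \<in> W \<Longrightarrow> card {r \<in> R. \<not> arc w r} \<le> 2 * \<kappa>"
    and W_to_B: "W' \<subseteq> W \<Longrightarrow> B' \<subseteq> B \<Longrightarrow> 2 * \<kappa> < card W' \<Longrightarrow> 2 * \<kappa> < card B' \<Longrightarrow> \<exists>w\<in>W'. \<exists>b\<in>B'. arc w b"
    and balanced: "card W \<le> card B + 1" "card B \<le> card W + 1"
    and card_R: "100 * (\<kappa> + 1) \<le> card R"
begin

lemma finite_layers [simp]: "finite R" "finite W" "finite B"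
  using layers(1) finite_V by (auto intro: finite_subset)

text \<open>Greedy choice: two consecutive vertices of \<open>bs\<close> exclude at most 4\<kappa>
  vertices of \<open>R\<close>, so a fresh one dominates both. \<open>A\<close> collects the
  forbidden vertices.\<close>

lemma zigzag:
  assumes "distinct bs" "set bs \<subseteq> B" "finite A" "4 * \<kappa> + length bs < card (R - A)"
  shows "\<exists>qs. alt_path arc (R \<union> B) qs \<and> length qs = 2 * length bs \<and> role False qs = set bs \<and>
    fst ` set qs \<subseteq> (R - A) \<union> set bs \<and> (bs \<noteq> [] \<longrightarrow> qs \<noteq> [] \<and> hd qs = (hd bs, False))"
  using assms
proof (induction bs arbitrary: A)
  case Nil
  show ?case by (intro exI[of _ "[]"]) (auto simp: role_def)
next
  case (Cons b bs)
  define c where "c = (if bs = [] then b else hd bs)"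
  have c: "c \<in> B" using Cons.prems by (auto simp: c_def)
  have "card (R - A) \<le> card ((R - A) \<inter> {r. arc r b \<and> arc r c} \<union> {r \<in> R. \<not> arc r b} \<union> {r \<in> R. \<not> arc r c})"
    by (intro card_mono) auto
  also have "\<dots> \<le> card ((R - A) \<inter> {r. arc r b \<and> arc r c}) + card {r \<in> R. \<not> arc r b} + card {r \<in> R. \<not> arc r c}"
    by (meson card_Un_le add_le_mono1 order_trans)
  also have "\<dots> \<le> card ((R - A) \<inter> {r. arc r b \<and> arc r c}) + 4 * \<kappa>"
    using R_to_B[of b] R_to_B[OF c] Cons.prems by simp
  finally have "0 < card ((R - A) \<inter> {r. arc r b \<and> arc r c})" using Cons.prems by simp
  then obtain r where r: "r \<in> R - A" "arc r b" "arc r c" by (auto simp: card_gt_0_iff)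
  have "card (R - insert r A) = card (R - A) - 1"
    using r by (subst Diff_insert) simp
  then have "4 * \<kappa> + length bs < card (R - insert r A)" using Cons.prems by simp
  then obtain qs where qs: "alt_path arc (R \<union> B) qs" "length qs = 2 * length bs" "role False qs = set bs"
      "fst ` set qs \<subseteq> (R - insert r A) \<union> set bs" "bs \<noteq> [] \<longrightarrow> qs \<noteq> [] \<and> hd qs = (hd bs, False)"
    using Cons.IH[of "insert r A"] Cons.prems by auto
  have "r \<noteq> b" "b \<notin> R" "r \<notin> B" using r layers Cons.prems by auto
  then have "alt_path arc (R \<union> B) ((b, False) # (r, True) # qs)"
    using qs r Cons.prems by (auto simp: alt_path_Cons_iff adj_def c_def split: if_splits)
  moreover have "role False ((b, False) # (r, True) # qs) = set (b # bs)"
    using qs by (simp add: role_Cons)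
  ultimately show ?case using qs r
    by (intro exI[of _ "(b, False) # (r, True) # qs"]) auto
qed

text \<open>The threshold leaves more than \<kappa> out-neighbours, enough for
  \<open>ex_arc\<close>, after discarding 4 vertices of a start and the 2\<kappa> that may not
  dominate a given vertex of \<open>B\<close>.\<close>

definition "good = {r \<in> R. 3 * \<kappa> + 5 \<le> card {y \<in> R. arc r y}}"

lemma card_good: "card R \<le> card good + 7 * \<kappa> + 10"
proof -
  have "card R \<le> card (good \<union> {x \<in> R. card {y \<in> R. arc x y} < 3 * \<kappa> + 5})"
    by (intro card_mono) (auto simp: good_def)
  also have "\<dots> \<le> card good + card {x \<in> R. card {y \<in> R. arc x y} < 3 * \<kappa> + 5}"
    by (rule card_Un_le)
  finally show ?thesis using card_low_outdegree[of R "3 * \<kappa> + 5"] layers by simp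
qed

text \<open>A start leads from the prescribed sink \<open>f\<close> to a vertex with many
  continuations. Its length pays for the vertices of \<open>B\<close> that it uses, and it removes
  few vertices of \<open>W\<close> from the later search.\<close>

definition start :: "'a \<Rightarrow> ('a \<times> bool) list \<Rightarrow> bool" where
  "start f hs \<longleftrightarrow> alt_path arc (R \<union> W \<union> B) hs \<and> hs \<noteq> [] \<and> hd hs = (f, False) \<and> snd (last hs) \<and>
     fst (last hs) \<in> good \<and> length hs \<le> 4 \<and> 2 * card (B \<inter> fst ` set hs) \<le> length hs \<and>
     card (W \<inter> fst ` set hs) \<le> 2"

text \<open>
  A vertex without a start has no in-neighbour in \<open>good\<close>, so it dominates almost all of \<open>good\<close>.
  Hence an arc \<open>g \<rightarrow> f\<close> between two such vertices extends to a start \<open>f \<leftarrow> g \<rightarrow> r1 \<leftarrow> r2\<close>.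
\<close>

lemma card_no_start: "card {f \<in> R \<union> W \<union> B. \<nexists>hs. start f hs} \<le> \<kappa>"
proof (rule card_arcless)
  show "{f \<in> R \<union> W \<union> B. \<nexists>hs. start f hs} \<subseteq> V" using layers by auto
next
  fix g f
  assume g: "g \<in> {f \<in> R \<union> W \<union> B. \<nexists>hs. start f hs}" and f: "f \<in> {f \<in> R \<union> W \<union> B. \<nexists>hs. start f hs}"
  have good: "good \<subseteq> R" by (auto simp: good_def)
  then have fin: "finite good" by (rule finite_subset) simp
  have no_in: "\<not> arc r h" if "h \<in> {f \<in> R \<union> W \<union> B. \<nexists>hs. start f hs}" "r \<in> good" for h r
  proof
    assume a: "arc r h"
    have "r \<noteq> h" using a asym by auto
    moreover have "r \<in> R" using that good by auto
    then have "B \<inter> {h, r} \<subseteq> {h}" "W \<inter> {h, r} \<subseteq> {h}" using layers by auto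
    then have "card (B \<inter> {h, r}) \<le> 1" "card (W \<inter> {h, r}) \<le> 1"
      using card_mono[of "{h}"] by force+
    ultimately have "start h [(h, False), (r, True)]"
      using that a \<open>r \<in> R\<close> by (auto simp: start_def alt_path_Cons_iff adj_def)
    then show False using that by auto
  qed
  show "\<not> arc g f"
  proof
    assume a: "arc g f"
    have gV: "g \<in> V" using g layers by auto
    define Y where "Y = {r \<in> good. arc g r} - {f}"
    have "card good \<le> card (Y \<union> {f} \<union> {y \<in> V. \<not> arc g y \<and> \<not> arc y g})"
      using finite_V fin good layers no_in[OF g] by (intro card_mono) (auto simp: Y_def)
    also have "\<dots> \<le> card Y + card {f} + card {y \<in> V. \<not> arc g y \<and> \<not> arc y g}"
      by (meson card_Un_le add_le_mono1 order_trans)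
    finally have "\<kappa> < card Y" using nonadjacent[OF gV] card_good card_R by simp
    then obtain r2 r1 where r: "r2 \<in> Y" "r1 \<in> Y" "arc r2 r1"
      using ex_arc[of Y] good layers(1) unfolding Y_def by blast
    have ne: "g \<noteq> f" "r1 \<noteq> r2" "r1 \<noteq> f" "r2 \<noteq> f" "r1 \<noteq> g" "r2 \<noteq> g"
      using a r asym by (auto simp: Y_def)
    have rR: "r1 \<in> R" "r2 \<in> R" using r good by (auto simp: Y_def)
    then have "B \<inter> {f, g, r1, r2} \<subseteq> {f, g}" "W \<inter> {f, g, r1, r2} \<subseteq> {f, g}" using layers by auto
    then have "card (B \<inter> {f, g, r1, r2}) \<le> card {f, g}" "card (W \<inter> {f, g, r1, r2}) \<le> card {f, g}"
      by (intro card_mono; simp)+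
    moreover have "card {f, g} = 2" using ne by simp
    ultimately have "start f [(f, False), (g, True), (r1, False), (r2, True)]"
      using a r ne rR f g by (auto simp: start_def alt_path_Cons_iff adj_def Y_def)
    then show False using f by auto
  qed
qed


text \<open>The start is continued by \<open>r3\<close> and \<open>r4\<close> into a zigzag. If the
  zigzag exhausts \<open>B - H\<close>, the path is long enough because \<open>W\<close> and
  \<open>B\<close> are balanced. Otherwise a depth-first path from \<open>W\<close> to the rest of
  \<open>B\<close> and \<open>R\<close> is linked to its end.\<close>

lemma long_path_from_start:
  assumes "start f hs"
  shows "\<exists>qs. alt_path arc (R \<union> W \<union> B) qs \<and> qs \<noteq> [] \<and> hd qs = (f, False) \<and> card W + card B < length qs"
proof -
  define H where "H = fst ` set hs"
  define r where "r = fst (last hs)"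
  have hs: "alt_path arc (R \<union> W \<union> B) hs" "hs \<noteq> []" "hd hs = (f, False)" "last hs = (r, True)" "r \<in> good"
      "length hs \<le> 4" "2 * card (B \<inter> H) \<le> length hs" "card (W \<inter> H) \<le> 2"
    using assms by (auto simp: start_def H_def r_def prod_eq_iff)
  have H: "finite H" "card H \<le> 4"
    using hs(6) card_image_le[of "set hs" fst] card_length[of hs] by (auto simp: H_def)
  define p where "p = 16 * \<kappa> + 20"
  obtain B0 where B0: "B0 \<subseteq> B - H" "card B0 = min (card (B - H)) p"
    using obtain_subset_with_card_n[of "min (card (B - H)) p" "B - H"] by auto
  have finB0: "finite B0" using B0(1) by (rule finite_subset) simp
  then obtain bs where bs: "set bs = B0" "distinct bs" using finite_distinct_list by blast
  have len_bs: "length bs = min (card (B - H)) p" using bs B0 distinct_card by metis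
  \<comment> \<open>\<open>ex_arc\<close> does not control the direction of its arc, so every
    element of \<open>Y\<close> can follow \<open>r\<close> and also precede \<open>hd bs\<close>.
    The guard covers empty \<open>bs\<close>, where \<open>hd bs\<close> is unspecified.\<close>
  define Y where "Y = {x \<in> R. arc r x \<and> (bs \<noteq> [] \<longrightarrow> arc x (hd bs))} - H"
  have finY: "finite Y" by (auto simp: Y_def)
  have miss: "card {x \<in> R. bs \<noteq> [] \<and> \<not> arc x (hd bs)} \<le> 2 * \<kappa>"
    using R_to_B[of "hd bs"] bs B0 by (cases bs) auto
  have "3 * \<kappa> + 5 \<le> card {x \<in> R. arc r x}" using hs(5) by (simp add: good_def)
  also have "\<dots> \<le> card (Y \<union> {x \<in> R. bs \<noteq> [] \<and> \<not> arc x (hd bs)} \<union> H)"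
    using finY H by (intro card_mono) (auto simp: Y_def)
  also have "\<dots> \<le> card Y + card {x \<in> R. bs \<noteq> [] \<and> \<not> arc x (hd bs)} + card H"
    by (meson card_Un_le add_le_mono1 order_trans)
  finally have "\<kappa> < card Y" using miss H by linarith
  moreover have "Y \<subseteq> V" using layers(1) by (auto simp: Y_def)
  ultimately obtain r4 r3 where r34: "r4 \<in> Y" "r3 \<in> Y" "arc r4 r3" using ex_arc by blast
  have r34_ne: "r4 \<noteq> r3" using r34 asym by auto
  define A where "A = insert r3 (insert r4 H)"
  have finA: "finite A" and cardA: "card A \<le> 6"
    using H card_insert_le_m1[of 5 H r4] card_insert_le_m1[of 6 "insert r4 H" r3] by (auto simp: A_def)
  have "card R - card A \<le> card (R - A)" using finA by (rule diff_card_le_card_Diff)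
  then have "4 * \<kappa> + length bs < card (R - A)"
    using card_R cardA len_bs by (simp add: p_def)
  then obtain zs where zs: "alt_path arc (R \<union> B) zs" "length zs = 2 * length bs" "role False zs = set bs"
      "fst ` set zs \<subseteq> (R - A) \<union> set bs" "bs \<noteq> [] \<longrightarrow> zs \<noteq> [] \<and> hd zs = (hd bs, False)"
    using zigzag[of bs A] bs B0 finA by auto
  define ps where "ps = hs @ (r3, False) # (r4, True) # zs"
  have r34R: "r3 \<in> R" "r4 \<in> R" "r3 \<notin> H" "r4 \<notin> H" using r34 by (auto simp: Y_def)
  have "alt_path arc (R \<union> W \<union> B) zs" using zs(1) by (rule alt_path_mono) auto
  moreover have "r3 \<notin> fst ` set zs" "r4 \<notin> fst ` set zs" "H \<inter> fst ` set zs = {}"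
    using zs(4) bs B0 r34R layers by (auto simp: A_def)
  moreover have "zs = [] \<or> adj arc (r4, True) (hd zs)"
    using zs r34 by (cases "bs = []") (auto simp: Y_def adj_def)
  moreover have "adj arc (r, True) (r3, False)" "adj arc (r3, False) (r4, True)"
    using r34 by (auto simp: Y_def adj_def)
  ultimately have ps: "alt_path arc (R \<union> W \<union> B) ps"
    unfolding ps_def using hs r34R r34_ne by (auto simp: alt_path_append_iff alt_path_Cons_iff H_def)
  have len_ps: "length ps = length hs + 2 + 2 * length bs" using zs by (simp add: ps_def)
  have hd_ps: "ps \<noteq> []" "hd ps = (f, False)" using hs by (auto simp: ps_def)
  have cardB: "card B = card (B - H) + card (B \<inter> H)"
    by (metis card_Diff_subset_Int card_mono finite_layers(3) inf_le1 le_add_diff_inverse2 finite_Int)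
  show ?thesis
  proof (cases "card (B - H) \<le> p")
    case True
    then have "card W + card B < length ps"
      using len_ps len_bs cardB hs(7) balanced by simp
    then show ?thesis using ps hd_ps by blast
  next
    case False
    then have len_bs: "length bs = p" using len_bs by simp
    define R2 where "R2 = R - fst ` set ps"
    define W2 where "W2 = W - H"
    define Y2 where "Y2 = (B - H - B0) \<union> R2"
    have "card (fst ` set ps) \<le> length ps" using card_image_le[of "set ps" fst] card_length[of ps] by simp
    moreover have "card R - card (fst ` set ps) \<le> card R2"
      unfolding R2_def by (rule diff_card_le_card_Diff) simp
    ultimately have R2: "68 * \<kappa> + 54 \<le> card R2"
      using len_ps len_bs hs(6) card_R by (simp add: p_def)
    have "card (B - H - B0) = card (B - H) - p"
      using B0 finB0 False by (subst card_Diff_subset) auto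
    moreover have "card Y2 = card (B - H - B0) + card R2"
      unfolding Y2_def using layers by (intro card_Un_disjoint) (auto simp: R2_def)
    ultimately have Y2: "card B - 3 \<le> card Y2" using R2 cardB hs(6,7) False by (simp add: p_def)
    have "card W = card W2 + card (W \<inter> H)" unfolding W2_def
      by (metis card_Diff_subset_Int card_mono finite_layers(2) inf_le1 le_add_diff_inverse2 finite_Int)
    \<comment> \<open>Two vertices of \<open>W\<close> may lie in \<open>H\<close>, and the
      imbalance costs one more.\<close>
    then have W2: "card B - 3 \<le> card W2" using hs(8) balanced by linarith
    \<comment> \<open>So large a \<open>Y'\<close> has more than 2\<kappa> vertices in
      \<open>B\<close> or in \<open>R\<close>. In \<open>B\<close>, \<open>W_to_B\<close> applies;
      in \<open>R\<close>, any single \<open>w\<close> suffices.\<close>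
    have dense: "\<exists>x\<in>W'. \<exists>y\<in>Y'. arc x y"
      if sub: "W' \<subseteq> W2" "Y' \<subseteq> Y2" and card: "4 * \<kappa> + 2 \<le> card W'" "4 * \<kappa> + 2 \<le> card Y'" for W' Y'
    proof -
      have fin: "finite Y'" using sub(2) by (rule finite_subset) (simp add: Y2_def R2_def)
      have "Y' = (Y' \<inter> B) \<union> (Y' \<inter> R)" using sub by (auto simp: Y2_def R2_def)
      then have "card Y' \<le> card (Y' \<inter> B) + card (Y' \<inter> R)" by (metis card_Un_le)
      then consider "2 * \<kappa> < card (Y' \<inter> B)" | "2 * \<kappa> < card (Y' \<inter> R)" using card by linarith
      then show ?thesis
      proof cases
        case 1
        then show ?thesis using W_to_B[of W' "Y' \<inter> B"] sub card by (auto simp: W2_def)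
      next
        case 2
        obtain w where w: "w \<in> W'" using card by fastforce
        have "\<not> Y' \<inter> R \<subseteq> {x \<in> R. \<not> arc w x}"
          using 2 W_to_R[of w] w sub card_mono[of "{x \<in> R. \<not> arc w x}" "Y' \<inter> R"] by (auto simp: W2_def)
        then show ?thesis using w by auto
      qed
    qed
    have fin: "finite W2" "finite Y2" and sep: "W2 \<inter> Y2 = {}"
      using layers by (auto simp: W2_def Y2_def R2_def)
    obtain qs where qs: "alt_path arc (W2 \<union> Y2) qs" "role True qs \<subseteq> W2"
        "2 * (card B - 3) \<le> length qs + 4 * (4 * \<kappa> + 2) + 1"
      using long_alternating_path[of W2 Y2 "4 * \<kappa> + 2" arc "card B - 3"] fin sep dense W2 Y2 by auto
    have qs': "alt_path arc (R \<union> W \<union> B) qs"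
      using qs(1) by (rule alt_path_mono) (auto simp: W2_def Y2_def R2_def)
    define m where "m = 2 * \<kappa> + 1"
    have large: "16 * \<kappa> + 20 < card B" using False cardB by (simp add: p_def)
    have len: "2 * m \<le> length ps" "2 * m \<le> length qs" "2 * m \<le> length zs"
      using len_ps len_bs zs(2) qs(3) large by (auto simp: m_def p_def)
    have disj: "fst ` set ps \<inter> fst ` set qs = {}"
    proof -
      have "fst ` set qs \<subseteq> W2 \<union> Y2" using qs(1) by (simp add: alt_path_def)
      moreover have "fst ` set ps \<subseteq> H \<union> R \<union> B0"
        using zs(4) bs r34R by (auto simp: ps_def H_def)
      then have "fst ` set ps \<inter> (W2 \<union> Y2) = {}"
        using layers(2-) B0(1) unfolding W2_def Y2_def R2_def by blast
      ultimately show ?thesis by blast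
    qed
    \<comment> \<open>The final window of \<open>ps\<close> lies inside the zigzag, so all its sinks
      are in \<open>B\<close>.\<close>
    have drop: "drop (length ps - 2 * m) ps = drop (length zs - 2 * m) zs"
    proof -
      have "length ps - 2 * m = length (hs @ [(r3, False), (r4, True)]) + (length zs - 2 * m)"
        using len by (simp add: ps_def)
      moreover have "ps = (hs @ [(r3, False), (r4, True)]) @ zs" by (simp add: ps_def)
      ultimately show ?thesis by (simp only: drop_append) simp
    qed
    have drop_zs: "alt_path arc (R \<union> B) (drop (length zs - 2 * m) zs)"
      using zs(1) append_take_drop_id[of "length zs - 2 * m" zs] by (metis alt_path_append_iff)
    have take_qs: "alt_path arc (W2 \<union> Y2) (take (2 * m) qs)"
      using qs(1) append_take_drop_id[of "2 * m" qs] by (metis alt_path_append_iff)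
    have "2 * \<kappa> < card (role True (take (2 * m) qs))"
      using length_le_role[OF take_qs, of True] len by (simp add: m_def)
    moreover have "2 * \<kappa> < card (role False (drop (length zs - 2 * m) zs))"
      using length_le_role[OF drop_zs, of False] len by (simp add: m_def)
    moreover have "role True (take (2 * m) qs) \<subseteq> W"
      using qs(2) set_take_subset[of "2 * m" qs] by (auto simp: role_def W2_def)
    moreover have "role False (drop (length zs - 2 * m) zs) \<subseteq> B"
      using zs(3) bs B0 set_drop_subset[of _ zs] by (fastforce simp: role_def)
    ultimately obtain w b where "w \<in> role True (take (2 * m) qs)"
        "b \<in> role False (drop (length ps - 2 * m) ps)" "arc w b"
      using W_to_B unfolding drop by meson
    from alt_path_link[OF ps qs' disj len(1,2) this]
    obtain rs where rs: "alt_path arc (R \<union> W \<union> B) rs" "rs \<noteq> []" "hd rs = (f, False)"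
        "length ps + length qs \<le> length rs + 4 * m"
      using hd_ps by auto
    have "card W + card B < length rs"
      using rs(4) len_ps len_bs qs(3) large balanced by (simp add: m_def p_def)
    then show ?thesis using rs by blast
  qed
qed

lemma card_no_long_path:
  "card {f \<in> R \<union> W \<union> B. \<nexists>qs. alt_path arc (R \<union> W \<union> B) qs \<and> qs \<noteq> [] \<and> hd qs = (f, False) \<and>
      card W + card B < length qs} \<le> \<kappa>"
proof -
  have "card {f \<in> R \<union> W \<union> B. \<nexists>qs. alt_path arc (R \<union> W \<union> B) qs \<and> qs \<noteq> [] \<and> hd qs = (f, False) \<and>
      card W + card B < length qs} \<le> card {f \<in> R \<union> W \<union> B. \<nexists>hs. start f hs}"
    by (intro card_mono) (auto dest: long_path_from_start)
  then show ?thesis using card_no_start by (rule order_trans)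
qed

text \<open>This transfers the long paths starting at sinks to paths starting at sources.\<close>

lemma layered_converse: "layered V (\<lambda>x y. arc y x) \<kappa> R B W"
proof -
  interpret converse: near_tournament V "\<lambda>x y. arc y x" \<kappa> by (rule near_tournament_converse)
  show ?thesis
  proof
    fix W' B' assume "W' \<subseteq> B" "B' \<subseteq> W" "2 * \<kappa> < card W'" "2 * \<kappa> < card B'"
    then show "\<exists>w\<in>W'. \<exists>b\<in>B'. arc b w" using W_to_B[of B' W'] by blast
  qed (use layers R_to_B W_to_R balanced card_R in auto)
qed

end

section \<open>Longest paths\<close>

lemma alt_path_converse: "alt_path arc X (map (apsnd Not) ps) \<longleftrightarrow> alt_path (\<lambda>x y. arc y x) X ps"
proof -
  have "successively (\<lambda>p q. adj arc (apsnd Not p) (apsnd Not q)) ps \<longleftrightarrow> successively (adj (\<lambda>x y. arc y x)) ps"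
    by (intro successively_cong) (auto simp: adj_def)
  then show ?thesis by (simp add: alt_path_def successively_map image_image comp_def)
qed

context near_tournament
begin

text \<open>These are the arcs by which a path starting at \<open>f\<close>, in the role opposite to
  that of \<open>z\<close>, could be attached to \<open>z\<close>.\<close>

definition wrong_way :: "'v \<times> bool \<Rightarrow> 'v \<Rightarrow> bool" where
  "wrong_way z f \<longleftrightarrow> (if snd z then arc (fst z) f else arc f (fst z))"

text \<open>Few wrong-way arcs and at most \<kappa> non-neighbours leave at most 2\<kappa>
  exceptions in the reservoir, \<open>R\<close> and the earlier vertices, that each vertex meets on
  removal. Alternation on the prefix gives balance.\<close>

lemma layered_prefix:
  assumes P: "alt_path arc V P" and R: "R = V - fst ` set P" "100 * (\<kappa> + 1) \<le> card R"
    and few: "\<And>j. j < i \<Longrightarrow> card {f \<in> R \<union> fst ` set (take j P). wrong_way (P ! j) f} \<le> \<kappa>"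
    and i: "i \<le> length P"
  shows "layered V arc \<kappa> R (role False (take i P)) (role True (take i P))"
proof -
  interpret converse: near_tournament V "\<lambda>x y. arc y x" \<kappa> by (rule near_tournament_converse)
  have take: "alt_path arc V (take i P)"
    using P append_take_drop_id[of i P] by (metis alt_path_append_iff)
  have finR: "finite R" using R finite_V by simp
  have PV: "fst ` set P \<subseteq> V" using P by (simp add: alt_path_def)
  have prefix: "fst ` set (take j P) \<subseteq> V" for j using PV set_take_subset[of j P] by auto
  have idx: "\<exists>j<i. P ! j = (x, s)" if "x \<in> role s (take i P)" for x s
    using that i by (auto simp: role_def in_set_conv_nth)
  have source: "card {y \<in> R \<union> fst ` set (take j P). \<not> arc y x} \<le> 2 * \<kappa>" if "j < i" "P ! j = (x, True)" for j x
    using card_not_in[of x "R \<union> fst ` set (take j P)"] few[OF that(1)] that R prefix PV i nth_mem[of j P]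
    by (force simp: wrong_way_def)
  have sink: "card {y \<in> R \<union> fst ` set (take j P). \<not> arc x y} \<le> 2 * \<kappa>" if "j < i" "P ! j = (x, False)" for j x
    using converse.card_not_in[of x "R \<union> fst ` set (take j P)"] few[OF that(1)] that R prefix PV i nth_mem[of j P]
    by (force simp: wrong_way_def)
  have balance: "card (role s (take i P)) \<le> card (role (\<not> s) (take i P)) + 1" for s
    using role_le_length[OF take, of s] length_eq_card_roles[of "take i P" s] take by (auto simp: alt_path_def)
  have earlier: "{x \<in> X. pos x < j} \<subseteq> fst ` set (take j P)"
    if "X \<subseteq> role s (take i P)" "\<And>x. x \<in> X \<Longrightarrow> P ! pos x = (x, s)" "j \<le> i" for X pos s j
  proof
    fix x assume x: "x \<in> {x \<in> X. pos x < j}"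
    then have "(x, s) = P ! pos x" "pos x < j" using that by auto
    then have "(x, s) \<in> set (take j P)" using that i by (auto simp: in_set_conv_nth)
    then show "x \<in> fst ` set (take j P)" by force
  qed
  show ?thesis
  proof
    show "R \<union> role False (take i P) \<union> role True (take i P) \<subseteq> V"
      using R prefix[of i] role_subset[of _ "take i P"] by blast
    show "R \<inter> role False (take i P) = {}" "R \<inter> role True (take i P) = {}"
      using R role_subset[of _ "take i P"] set_take_subset[of i P] by blast+
    show "role False (take i P) \<inter> role True (take i P) = {}"
    proof (intro equals0I)
      fix x assume "x \<in> role False (take i P) \<inter> role True (take i P)"
      then have "(x, False) \<in> set (take i P)" "(x, True) \<in> set (take i P)" by (auto simp: role_def)
      moreover have "inj_on fst (set (take i P))" using take unfolding alt_path_def distinct_map by blast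
      ultimately show False using inj_onD[of fst "set (take i P)" "(x, False)" "(x, True)"] by simp
    qed
  next
    fix b assume "b \<in> role True (take i P)"
    then obtain j where j: "j < i" "P ! j = (b, True)" using idx by blast
    have "card {r \<in> R. \<not> arc r b} \<le> card {y \<in> R \<union> fst ` set (take j P). \<not> arc y b}"
      using finR by (intro card_mono) auto
    then show "card {r \<in> R. \<not> arc r b} \<le> 2 * \<kappa>" using source[OF j] by linarith
  next
    fix w assume "w \<in> role False (take i P)"
    then obtain j where j: "j < i" "P ! j = (w, False)" using idx by blast
    have "card {r \<in> R. \<not> arc w r} \<le> card {y \<in> R \<union> fst ` set (take j P). \<not> arc w y}"
      using finR by (intro card_mono) auto
    then show "card {r \<in> R. \<not> arc w r} \<le> 2 * \<kappa>" using sink[OF j] by linarith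
  next
    fix W' B'
    assume W': "W' \<subseteq> role False (take i P)" "2 * \<kappa> < card W'" and B': "B' \<subseteq> role True (take i P)" "2 * \<kappa> < card B'"
    have fin: "finite W'" "finite B'" using W' B' by (auto intro: finite_subset[OF _ finite_role])
    have ne: "W' \<noteq> {}" "B' \<noteq> {}" using W' B' by auto
    have "\<forall>x\<in>W'. \<exists>j. j < i \<and> P ! j = (x, False)" using idx W' by blast
    then obtain wpos where wpos: "\<And>x. x \<in> W' \<Longrightarrow> wpos x < i \<and> P ! wpos x = (x, False)"
      by (auto dest!: bchoice)
    have "\<forall>x\<in>B'. \<exists>j. j < i \<and> P ! j = (x, True)" using idx B' by blast
    then obtain bpos where bpos: "\<And>x. x \<in> B' \<Longrightarrow> bpos x < i \<and> P ! bpos x = (x, True)"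
      by (auto dest!: bchoice)
    have "Max (wpos ` W') \<in> wpos ` W'" using fin(1) ne(1) by simp
    then obtain w where "w \<in> W'" "wpos w = Max (wpos ` W')" by auto
    then have w: "w \<in> W'" "\<And>x. x \<in> W' \<Longrightarrow> wpos x \<le> wpos w" using fin(1) by auto
    have "Max (bpos ` B') \<in> bpos ` B'" using fin(2) ne(2) by simp
    then obtain b where "b \<in> B'" "bpos b = Max (bpos ` B')" by auto
    then have b: "b \<in> B'" "\<And>x. x \<in> B' \<Longrightarrow> bpos x \<le> bpos b" using fin(2) by auto
    \<comment> \<open>The vertex of \<open>W' \<union> B'\<close> that was removed last had all of the other class in its reservoir.\<close>
    have "wpos w \<noteq> bpos b" using wpos[OF w(1)] bpos[OF b(1)] by auto
    then consider "bpos b < wpos w" | "wpos w < bpos b" by linarith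
    then show "\<exists>w\<in>W'. \<exists>b\<in>B'. arc w b"
    proof cases
      case 1
      then have "B' \<subseteq> {x \<in> B'. bpos x < wpos w}" using b(2) by force
      also have "\<dots> \<subseteq> fst ` set (take (wpos w) P)"
        by (rule earlier[OF B'(1)]) (use bpos wpos[OF w(1)] in auto)
      finally have sub: "B' \<subseteq> fst ` set (take (wpos w) P)" .
      have "\<not> B' \<subseteq> {y \<in> R \<union> fst ` set (take (wpos w) P). \<not> arc w y}"
        using sink[of "wpos w" w] wpos[OF w(1)] B'(2) finR
          card_mono[of "{y \<in> R \<union> fst ` set (take (wpos w) P). \<not> arc w y}" B'] by auto
      then show ?thesis using sub w by auto
    next
      case 2
      then have "W' \<subseteq> {x \<in> W'. wpos x < bpos b}" using w(2) by force
      also have "\<dots> \<subseteq> fst ` set (take (bpos b) P)"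
        by (rule earlier[OF W'(1)]) (use wpos bpos[OF b(1)] in auto)
      finally have sub: "W' \<subseteq> fst ` set (take (bpos b) P)" .
      have "\<not> W' \<subseteq> {y \<in> R \<union> fst ` set (take (bpos b) P). \<not> arc y b}"
        using source[of "bpos b" b] bpos[OF b(1)] W'(2) finR
          card_mono[of "{y \<in> R \<union> fst ` set (take (bpos b) P). \<not> arc y b}" W'] by auto
      then show ?thesis using sub b by auto
    qed
  qed (use R balance[of True] balance[of False] in auto)
qed

lemma ex_long_alt_path: "\<exists>ps. alt_path arc V ps \<and> card V < length ps + 100 * (\<kappa> + 1)"
proof (rule ccontr)
  assume no_long: "\<not> ?thesis"
  have bound: "length ps \<le> card V" if "alt_path arc V ps" for ps
    using that card_mono[OF finite_V, of "set (map fst ps)"] distinct_card[of "map fst ps"]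
    by (simp add: alt_path_def)
  obtain P where P: "alt_path arc V P" and max: "\<And>ps. alt_path arc V ps \<Longrightarrow> length ps \<le> length P"
    using ex_has_greatest_nat[of "alt_path arc V" "[]" length "Suc (card V)"] bound
    by (metis alt_path_Nil less_Suc_eq_le)
  define R where "R = V - fst ` set P"
  have PV: "fst ` set P \<subseteq> V" and dist: "distinct (map fst P)" using P by (auto simp: alt_path_def)
  have "card (fst ` set P) = length P" using distinct_card[OF dist] by simp
  then have "card R = card V - length P"
    unfolding R_def using PV by (subst card_Diff_subset) auto
  then have R: "100 * (\<kappa> + 1) \<le> card R" using no_long P by force
  have F_eq: "R \<union> role False (take i P) \<union> role True (take i P) = R \<union> fst ` set (take i P)" for i
    using role_Un[of False "take i P"] by auto
  have len: "card (role False (take i P)) + card (role True (take i P)) = i" if "i \<le> length P" for i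
  proof -
    have "distinct (map fst (take i P))" using dist by (simp add: take_map[symmetric])
    then show ?thesis using length_eq_card_roles[of "take i P" False] that by simp
  qed
  have few: "card {f \<in> R \<union> fst ` set (take i P). wrong_way (P ! i) f} \<le> \<kappa>" if "i < length P" for i
    using that
  \<comment> \<open>Layering the prefix of length \<open>i\<close> uses the bound at every earlier
    vertex.\<close>
  proof (induction i rule: less_induct)
    case (less i)
    define F where "F = R \<union> fst ` set (take i P)"
    interpret L: layered V arc \<kappa> R "role False (take i P)" "role True (take i P)"
      using layered_prefix[OF P R_def R] less by force
    interpret L': layered V "\<lambda>x y. arc y x" \<kappa> R "role True (take i P)" "role False (take i P)"
      by (rule L.layered_converse)
    define z where "z = P ! i"
    have dz: "drop i P = z # drop (Suc i) P" using less.prems by (simp add: z_def Cons_nth_drop_Suc)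
    have P_split: "P = take i P @ drop i P" by simp
    have FV: "F \<subseteq> V" using PV set_take_subset[of i P] by (auto simp: F_def R_def)
    then have finF: "finite F" using finite_V by (rule finite_subset)
    have F_disj: "F \<inter> fst ` set (drop i P) = {}"
    proof -
      have "fst ` set (take i P) \<inter> fst ` set (drop i P) = {}"
        using P P_split by (metis alt_path_append_iff)
      then show ?thesis using set_drop_subset[of i P] by (auto simp: F_def R_def)
    qed
    \<comment> \<open>The reversed \<open>qs\<close> can replace the first \<open>i\<close> vertices
      of \<open>P\<close>. As \<open>P\<close> is longest, \<open>qs\<close> has at most
      \<open>i\<close> vertices.\<close>
    have contra: "length qs \<le> i"
      if "alt_path arc F qs" "qs \<noteq> []" "hd qs = (f, \<not> snd z)" "wrong_way z f" for qs f
    proof -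
      have "alt_path arc V (drop i P)" using P P_split by (metis alt_path_append_iff)
      moreover have "alt_path arc V qs" using that(1) FV by (rule alt_path_mono)
      moreover have "fst ` set qs \<inter> fst ` set (drop i P) = {}" using F_disj that(1) by (auto simp: alt_path_def)
      moreover have "adj arc (hd qs) z" using that by (auto simp: adj_def wrong_way_def)
      ultimately have "alt_path arc V (rev qs @ drop i P)"
        using that(2) dz by (simp add: alt_path_append_iff last_rev)
      from max[OF this] show ?thesis using less.prems by simp
    qed
    show ?case
    proof (cases "snd z")
      case True
      \<comment> \<open>The two removed classes have \<open>i\<close> vertices together, so a path
        longer than their total contradicts \<open>contra\<close>.\<close>
      have "card {f \<in> F. wrong_way z f} \<le> card {f \<in> F. \<nexists>qs. alt_path arc F qs \<and> qs \<noteq> [] \<and> hd qs = (f, False) \<and> i < length qs}"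
        using contra True finF by (intro card_mono) (auto simp: not_less)
      then show ?thesis using L.card_no_long_path len[of i] less.prems
        by (simp add: F_eq F_def z_def)
    next
      case False
      \<comment> \<open>For a sink \<open>z\<close> the path is found in the converse digraph;
        flipping its flags brings it back.\<close>
      have "\<not> (alt_path (\<lambda>x y. arc y x) F qs \<and> qs \<noteq> [] \<and> hd qs = (f, False) \<and> i < length qs)"
        if "wrong_way z f" for qs f
        using contra[of "map (apsnd Not) qs" f] False that by (auto simp: alt_path_converse hd_map)
      then have "card {f \<in> F. wrong_way z f} \<le>
          card {f \<in> F. \<nexists>qs. alt_path (\<lambda>x y. arc y x) F qs \<and> qs \<noteq> [] \<and> hd qs = (f, False) \<and> i < length qs}"
        using finF by (intro card_mono) auto
      moreover have "F = R \<union> role True (take i P) \<union> role False (take i P)" using F_eq[of i] by (auto simp: F_def)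
      ultimately show ?thesis using L'.card_no_long_path len[of i] less.prems
        by (simp add: F_def[symmetric] z_def[symmetric] add.commute)
    qed
  qed
  interpret L: layered V arc \<kappa> R "role False P" "role True P"
    using layered_prefix[OF P R_def R, of "length P"] few by simp
  have V_eq: "R \<union> role False P \<union> role True P = V"
    using role_Un[of False P] PV by (auto simp: R_def)
  have "card R \<le> card V" using finite_V by (intro card_mono) (auto simp: R_def)
  \<comment> \<open>Now all of \<open>P\<close> is removed. Since \<open>V\<close> has more than
    \<kappa> vertices, one of them starts a path longer than \<open>P\<close>.\<close>
  then have "\<not> V \<subseteq> {f \<in> V. \<nexists>qs. alt_path arc V qs \<and> qs \<noteq> [] \<and> hd qs = (f, False) \<and> length P < length qs}"
    using L.card_no_long_path R len[of "length P"] finite_V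
      card_mono[of "{f \<in> V. \<nexists>qs. alt_path arc V qs \<and> qs \<noteq> [] \<and> hd qs = (f, False) \<and> length P < length qs}" V]
    by (auto simp: V_eq)
  then show False using max by (auto simp: not_less[symmetric])
qed

end

section \<open>Oriented graphs\<close>

lemma set_vwalk_arcs_subset:
  "successively (\<lambda>x y. (x, y) \<in> S) xs \<Longrightarrow> set (vwalk_arcs xs) \<subseteq> S"
  by (induction xs rule: vwalk_arcs.induct) auto

text \<open>By \<open>no_2_cycles\<close> an arc points forwards exactly when its first vertex on
  the path is a source, and these flags alternate.\<close>

lemma antidirected_path_of_alt_path:
  assumes "oriented_graph D" and ps: "alt_path (\<lambda>x y. (x, y) \<in> parcs D) (pverts D) ps" "ps \<noteq> []"
  shows "antidirected_path D (map fst ps)"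
proof -
  interpret oriented_graph D by fact
  have step: "adj (\<lambda>x y. (x, y) \<in> parcs D) (ps ! i) (ps ! Suc i)" if "Suc i < length ps" for i
    using ps(1) that successively_nth unfolding alt_path_def by blast
  have forward: "(fst (ps ! i), fst (ps ! Suc i)) \<in> parcs D \<longleftrightarrow> snd (ps ! i)" if "Suc i < length ps" for i
    using step[OF that] no_2_cycles by (auto simp: adj_def split: if_splits)
  have sym: "(x, y) \<in> parcs (mk_symmetric (with_proj D)) \<longleftrightarrow> (x, y) \<in> parcs D \<or> (y, x) \<in> parcs D" for x y
    by (auto simp: parcs_mk_symmetric intro: bexI[of _ "(y, x)"])
  have "successively (\<lambda>p q. (fst p, fst q) \<in> parcs (mk_symmetric (with_proj D))) ps"
    by (rule successively_mono[of "adj (\<lambda>x y. (x, y) \<in> parcs D)"])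
      (use ps in \<open>auto simp: alt_path_def adj_def sym split: if_splits\<close>)
  then have "set (vwalk_arcs (map fst ps)) \<subseteq> parcs (mk_symmetric (with_proj D))"
    by (intro set_vwalk_arcs_subset) (simp add: successively_map)
  then have "oriented_path D (map fst ps)"
    using ps by (simp add: oriented_path_def vpath_def vwalk_def alt_path_def)
  moreover have "((map fst ps ! i, map fst ps ! (i + 1)) \<in> parcs D) \<noteq>
      ((map fst ps ! (i + 1), map fst ps ! (i + 2)) \<in> parcs D)" if "i + 2 < length (map fst ps)" for i
    using that forward[of i] forward[of "Suc i"] step[of i] by (auto simp: adj_def)
  ultimately show ?thesis by (simp add: antidirected_path_def)
qed

text \<open>The non-neighbours of \<open>x\<close>, with \<open>x\<close> itself, form the
  complement of \<open>neighbours D x\<close>.\<close>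

lemma near_tournament_oriented_graph:
  assumes "oriented_graph D" "pverts D \<noteq> {}"
  shows "near_tournament (pverts D) (\<lambda>x y. (x, y) \<in> parcs D) (card (pverts D) - min_degree D)"
proof -
  interpret oriented_graph D by fact
  show ?thesis
  proof
    fix x assume x: "x \<in> pverts D"
    have "{y \<in> pverts D. (x, y) \<notin> parcs D \<and> (y, x) \<notin> parcs D} = pverts D - neighbours D x"
      by (auto simp: neighbours_def)
    also have "card \<dots> = card (pverts D) - degree D x"
      unfolding degree_def by (rule card_Diff_subset) (auto simp: neighbours_def)
    finally show "card {y \<in> pverts D. (x, y) \<notin> parcs D \<and> (y, x) \<notin> parcs D} \<le> card (pverts D) - min_degree D"
      using x by (auto simp: min_degree_def intro!: diff_le_mono2)
  qed (use no_2_cycles in auto)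
qed

theorem theorem6:
  fixes \<epsilon> :: real and k :: "nat \<Rightarrow> real"
  assumes "\<epsilon> > 0"
    and "k \<in> o(\<lambda>n. real n)"
  shows "\<forall>\<^sub>F n in sequentially. \<forall>D :: 'a pair_pre_digraph.
           oriented_graph D \<and> card (pverts D) = n \<and> real (min_degree D) \<ge> real n - k n \<longrightarrow>
           (\<exists>xs. antidirected_path D xs \<and> real (vwalk_length xs) \<ge> (1 - \<epsilon>) * real n)"
proof -
  \<comment> \<open>The path will miss fewer than 100(\<kappa> + 1) vertices. The constant 400 makes
    100\<kappa> and 100 at most a quarter of \<epsilon>n each, with room for the step from vertices
    to arcs.\<close>
  have "\<forall>\<^sub>F n in sequentially. norm (k n) \<le> \<epsilon> / 400 * norm (real n)"
    using landau_o.smallD[OF assms(2), of "\<epsilon> / 400"] assms(1) by simp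
  moreover have "\<forall>\<^sub>F n in sequentially. 400 / \<epsilon> + 1 \<le> real n"
    by (rule eventually_compose_filterlim[OF eventually_ge_at_top filterlim_real_sequentially])
  ultimately show ?thesis
  proof eventually_elim
    case (elim n)
    show ?case
    proof (intro allI impI, elim conjE)
      fix D :: "'a pair_pre_digraph"
      assume D: "oriented_graph D" "card (pverts D) = n" "real (min_degree D) \<ge> real n - k n"
      interpret oriented_graph D by fact
      have "0 \<le> 400 / \<epsilon>" using assms(1) by simp
      then have n: "400 / \<epsilon> \<le> real n" "1 \<le> real n" using elim(2) by linarith+
      have n': "400 \<le> \<epsilon> * real n" using n(1) assms(1) by (simp add: field_simps)
      have V: "pverts D \<noteq> {}" using n D by auto
      then obtain v where v: "v \<in> pverts D" by auto
      define \<kappa> where "\<kappa> = n - min_degree D"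
      \<comment> \<open>This keeps the natural subtraction in \<kappa> from truncating.\<close>
      have "min_degree D \<le> degree D v" using v by (auto simp: min_degree_def)
      also have "\<dots> \<le> n" unfolding degree_def D(2)[symmetric] by (intro card_mono) (auto simp: neighbours_def)
      finally have "real \<kappa> \<le> k n" using D(3) by (simp add: \<kappa>_def of_nat_diff)
      then have \<kappa>: "400 * real \<kappa> \<le> \<epsilon> * real n" using elim(1) by simp
      interpret near_tournament "pverts D" "\<lambda>x y. (x, y) \<in> parcs D" \<kappa>
        using near_tournament_oriented_graph[OF D(1) V] D(2) by (simp add: \<kappa>_def)
      obtain qs where qs: "alt_path (\<lambda>x y. (x, y) \<in> parcs D) (pverts D) qs" "n < length qs + 100 * (\<kappa> + 1)"
        using ex_long_alt_path D(2) by blast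
      \<comment> \<open>The empty list is no \<open>oriented_path\<close>, so a single vertex
        replaces an empty \<open>qs\<close>.\<close>
      obtain ps where ps: "alt_path (\<lambda>x y. (x, y) \<in> parcs D) (pverts D) ps" "ps \<noteq> []" "length qs \<le> length ps"
      proof (cases "qs = []")
        case True
        then show ?thesis using that[of "[(v, True)]"] v by (simp add: alt_path_Cons_iff)
      qed (use qs that in blast)
      have "n < length ps + 100 * (\<kappa> + 1)" using qs(2) ps(3) by linarith
      then have "real n < real (length ps + 100 * (\<kappa> + 1))" by (simp only: of_nat_less_iff)
      moreover have "real (length ps - 1) = real (length ps) - 1" using ps(2) by (cases ps) auto
      ultimately have "(1 - \<epsilon>) * real n \<le> real (vwalk_length (map fst ps))"
        using n' \<kappa> by (simp add: algebra_simps)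
      then show "\<exists>xs. antidirected_path D xs \<and> real (vwalk_length xs) \<ge> (1 - \<epsilon>) * real n"
        using antidirected_path_of_alt_path[OF D(1) ps(1,2)] by blast
    qed
  qed
qed

end
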